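(* There exist a non-flat oriented 3-dimensional Lorentzian manifold $(M^3,g)$ and a non-null, non-degenerate, arc length parametrized curve $\alpha\colon I\to M^3$ ($I$ an open interval), with $g(\nabla_{\alpha'}\alpha',\nabla_{\alpha'}\alpha')\neq0$ at every point, such that the equi-affine curvatures of $\alpha$ are constant, precisely $\varkappa_1=\varkappa_2=0$ on $I$, while the Frenet curvature $\kappa$ and the Frenet torsion $\tau$ of $\alpha$ are both non-constant functions. (In particular, constancy of the equi-affine curvatures of such a curve in a 3-dimensional pseudo-Riemannian manifold does not in general imply constancy of its Frenet curvature and torsion.)
   Context: Let $(M^3,g)$ be a connected oriented 3-dimensional Lorentzian manifold (signature $(++-)$), $\nabla$ its Levi-Civita connection, and $\Omega$ its natural volume form compatible with the orientation, i.e. in positively oriented local coordinates $\Omega(\partial_i,\partial_j,\partial_k)=\sqrt{|G|}\,\varepsilon_{ijk}$, with $G=\det[g_{ij}]$ and $\varepsilon_{ijk}$ the Levi-Civita symbol (so $\Omega=1$ on positively oriented orthonormal frames). Put $\omega=\operatorname{sign}G=-1$. The cross product is defined by $g(X\times Y,Z)=\Omega(X,Y,Z)$ for all $Z$. Non-flat means that the curvature tensor is not identically zero. Frenet frame: let $\alpha\colon I\to M^3$ be a smooth non-null curve parametrized by arc length, $g(\alpha',\alpha')=\varepsilon_1\in\{1,-1\}$, with $g(\nabla_{\alpha'}\alpha',\nabla_{\alpha'}\alpha')\neq0$ everywhere. Put $\mathbf T=\alpha'$ and $\varepsilon_2=\operatorname{sign}g(\nabla_{\mathbf T}\mathbf T,\nabla_{\mathbf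 T}\mathbf T)$. The unit principal normal $\mathbf N$ and the positive function $\kappa$ (curvature) are defined by $\nabla_{\mathbf T}\mathbf T=\varepsilon_2\kappa\mathbf N$, $g(\mathbf N,\mathbf N)=\varepsilon_2$. Put $\varepsilon_3=\omega\varepsilon_1\varepsilon_2$ and $\mathbf B=\varepsilon_3\,\mathbf T\times\mathbf N$; then $g(\mathbf B,\mathbf B)=\varepsilon_3$ and $\Omega(\mathbf T,\mathbf N,\mathbf B)=1$. The torsion $\tau$ is the function with $\nabla_{\mathbf T}\mathbf N=-\varepsilon_1\kappa\mathbf T+\varepsilon_3\tau\mathbf B$; also $\nabla_{\mathbf T}\mathbf B=-\varepsilon_2\tau\mathbf N$. Equi-affine objects: $(M^3,\nabla,\Omega)$ is regarded as an equi-affine manifold. With $\nabla^2_{\alpha'}\alpha'=\nabla_{\alpha'}(\nabla_{\alpha'}\alpha')$, the curve $\alpha$ is non-degenerate if $\Omega(\alpha',\nabla_{\alpha'}\alpha',\nabla^2_{\alpha'}\alpha')\neq0$ at every point. Put $\varphi=|\Omega(\alpha',\nabla_{\alpha'}\alpha',\nabla^2_{\alpha'}\alpha')|^{-1/6}$. The Cartan frame is $\mathbf e_1=\varphi\alpha'$, $\mathbf e_2=\nabla_{\mathbf e_1}\mathbf e_1$, $\mathbf e_3=\nabla_{\mathbf e_1}\mathbf e_2$, where $\nabla_{\mathbf e_1}=\varphi\nabla_{\alpha'}$. The equi-affine curvatures $\varkappa_1,\varkappa_2$ are the unique functions on $I$ with $\nabla_{\mathbf e_1}\mathbf e_3=\varkappa_1\mathbf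 e_1+\varkappa_2\mathbf e_2$. *)

theory Defs
  imports "HOL-Analysis.Analysis"
begin

section \<open>Smooth maps\<close>

text \<open>For open \<open>S\<close>, \<open>Ck_on k S f\<close> is the usual \<open>C\<^sup>k\<close> condition: all partial derivatives of
  order at most \<open>k\<close> exist and are continuous on \<open>S\<close>. It is only used for open \<open>S\<close>.\<close>

primrec Ck_on :: "nat \<Rightarrow> 'a::euclidean_space set \<Rightarrow> ('a \<Rightarrow> 'b::real_normed_vector) \<Rightarrow> bool" where
  "Ck_on 0 S f \<longleftrightarrow> continuous_on S f"
| "Ck_on (Suc k) S f \<longleftrightarrow>
     f differentiable_on S \<and> (\<forall>b\<in>Basis. Ck_on k S (\<lambda>x. frechet_derivative f (at x) b))"

definition smooth_on :: "'a::euclidean_space set \<Rightarrow> ('a \<Rightarrow> 'b::real_normed_vector) \<Rightarrow> bool" where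
  "smooth_on S f \<longleftrightarrow> (\<forall>k. Ck_on k S f)"

definition partial_deriv :: "'n::finite \<Rightarrow> (real^'n \<Rightarrow> real) \<Rightarrow> real^'n \<Rightarrow> real" where
  "partial_deriv k f x = frechet_derivative f (at x) (axis k 1)"


section \<open>Oriented smooth manifolds\<close>

text \<open>Only the values of \<open>cmap c\<close> on \<open>cdom c\<close> matter.\<close>

record ('p, 'n) chart =
  cdom :: "'p set"
  cmap :: "'p \<Rightarrow> real^'n"

abbreviation cimage :: "('p, 'n::finite) chart \<Rightarrow> (real^'n) set" where
  "cimage c \<equiv> cmap c ` cdom c"

definition transition ::
    "('p, 'n::finite) chart \<Rightarrow> ('p, 'n) chart \<Rightarrow> real^'n \<Rightarrow> real^'n" where
  "transition c d = cmap d \<circ> inv_into (cdom c) (cmap c)"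

definition smooth_manifold :: "'p topology \<Rightarrow> ('p, 'n::finite) chart set \<Rightarrow> bool" where
  "smooth_manifold X A \<longleftrightarrow>
     Hausdorff_space X \<and> second_countable X \<and>
     topspace X = (\<Union>c\<in>A. cdom c) \<and>
     (\<forall>c\<in>A. openin X (cdom c) \<and> open (cimage c) \<and>
        homeomorphic_map (subtopology X (cdom c)) (top_of_set (cimage c)) (cmap c)) \<and>
     (\<forall>c\<in>A. \<forall>d\<in>A. smooth_on (cmap c ` (cdom c \<inter> cdom d)) (transition c d))"

text \<open>The orientation is the one for which all charts of the given atlas are positively oriented.\<close>

definition oriented_atlas :: "('p, 'n::finite) chart set \<Rightarrow> bool" where
  "oriented_atlas A \<longleftrightarrow>
     (\<forall>c\<in>A. \<forall>d\<in>A. \<forall>p\<in>cdom c \<inter> cdom d. det (jacobian (transition c d) (at (cmap c p))) > 0)"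


section \<open>Lorentzian metrics in dimension three\<close>

text \<open>Tensors are given by their components in each chart of the atlas. The metric is a family
  \<open>g\<close> of matrix-valued functions, \<open>g c x $ i $ j\<close> being the component \<open>g\<^sub>i\<^sub>j\<close> in the chart \<open>c\<close>
  at the point with coordinates \<open>x\<close>.\<close>

type_synonym ('p, 'n) metric = "('p, 'n) chart \<Rightarrow> real^'n \<Rightarrow> real^'n^'n"

definition lorentzian_matrix :: "real^3^3 \<Rightarrow> bool" where
  "lorentzian_matrix G \<longleftrightarrow> transpose G = G \<and>
     (\<exists>P :: real^3^3. invertible P \<and>
        transpose P ** G ** P = (\<chi> i j. if i = j then if i = 3 then -1 else 1 else 0))"

definition lorentzian_metric :: "('p, 3) chart set \<Rightarrow> ('p, 3) metric \<Rightarrow> bool" where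
  "lorentzian_metric A g \<longleftrightarrow>
     (\<forall>c\<in>A. smooth_on (cimage c) (g c) \<and> (\<forall>x\<in>cimage c. lorentzian_matrix (g c x))) \<and>
     (\<forall>c\<in>A. \<forall>d\<in>A. \<forall>p\<in>cdom c \<inter> cdom d.
        let J = jacobian (transition c d) (at (cmap c p))
        in g c (cmap c p) = transpose J ** g d (cmap d p) ** J)"

definition oriented_lorentzian_manifold ::
    "'p topology \<Rightarrow> ('p, 3) chart set \<Rightarrow> ('p, 3) metric \<Rightarrow> bool" where
  "oriented_lorentzian_manifold X A g \<longleftrightarrow>
     smooth_manifold X A \<and> oriented_atlas A \<and> connected_space X \<and> lorentzian_metric A g"


section \<open>Levi-Civita connection and curvature\<close>

text \<open>\<open>christoffel G x k i j\<close> is the component \<open>\<Gamma>\<^sup>k\<^sub>i\<^sub>j\<close>, where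
  \<open>\<nabla>\<^bsub>\<partial>i\<^esub> \<partial>\<^sub>j = \<Gamma>\<^sup>k\<^sub>i\<^sub>j \<partial>\<^sub>k\<close>. The theorem \<open>christoffel_unique\<close> below shows that this is the only
  torsion-free connection compatible with the metric.\<close>

definition christoffel :: "(real^'n::finite \<Rightarrow> real^'n^'n) \<Rightarrow> real^'n \<Rightarrow> 'n \<Rightarrow> 'n \<Rightarrow> 'n \<Rightarrow> real" where
  "christoffel G x k i j =
     (\<Sum>l\<in>UNIV. matrix_inv (G x) $ k $ l *
        (partial_deriv i (\<lambda>y. G y $ j $ l) x + partial_deriv j (\<lambda>y. G y $ i $ l) x
          - partial_deriv l (\<lambda>y. G y $ i $ j) x)) / 2"

text \<open>\<open>riemann G x l k i j\<close> is the coefficient of \<open>\<partial>\<^sub>l\<close> in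
  \<open>R(\<partial>\<^sub>i, \<partial>\<^sub>j)\<partial>\<^sub>k = \<nabla>\<^bsub>\<partial>i\<^esub> \<nabla>\<^bsub>\<partial>j\<^esub> \<partial>\<^sub>k - \<nabla>\<^bsub>\<partial>j\<^esub> \<nabla>\<^bsub>\<partial>i\<^esub> \<partial>\<^sub>k\<close>.\<close>

definition riemann ::
    "(real^'n::finite \<Rightarrow> real^'n^'n) \<Rightarrow> real^'n \<Rightarrow> 'n \<Rightarrow> 'n \<Rightarrow> 'n \<Rightarrow> 'n \<Rightarrow> real" where
  "riemann G x l k i j =
     partial_deriv i (\<lambda>y. christoffel G y l j k) x - partial_deriv j (\<lambda>y. christoffel G y l i k) x
     + (\<Sum>m\<in>UNIV. christoffel G x l i m * christoffel G x m j k
                  - christoffel G x l j m * christoffel G x m i k)"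

definition flat :: "('p, 'n::finite) chart set \<Rightarrow> ('p, 'n) metric \<Rightarrow> bool" where
  "flat A g \<longleftrightarrow> (\<forall>c\<in>A. \<forall>x\<in>cimage c. \<forall>l k i j. riemann (g c) x l k i j = 0)"

lemma christoffel_unique:
  fixes G :: "real^'n::finite \<Rightarrow> real^'n^'n" and C :: "'n \<Rightarrow> 'n \<Rightarrow> 'n \<Rightarrow> real"
  assumes "open U" "x \<in> U"
    and sym: "\<And>y. y \<in> U \<Longrightarrow> transpose (G y) = G y"
    and inv: "invertible (G x)"
    and diff: "\<And>i j. (\<lambda>y. G y $ i $ j) differentiable (at x)"
  shows "((\<forall>k i j. C k i j = C k j i) \<and>
          (\<forall>k i j. partial_deriv k (\<lambda>y. G y $ i $ j) x =
             (\<Sum>l\<in>UNIV. C l k i * G x $ l $ j + C l k j * G x $ i $ l)))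
         \<longleftrightarrow> C = christoffel G x"
proof -
  let ?H = "matrix_inv (G x)"
  define D where "D k i j = partial_deriv k (\<lambda>y. G y $ i $ j) x" for k i j
  define F where "F m i j = (D i j m + D j i m - D m i j) / 2" for m i j
  define L where "L C m i j = (\<Sum>l\<in>UNIV. G x $ m $ l * C l i j)"
    for C :: "'n \<Rightarrow> 'n \<Rightarrow> 'n \<Rightarrow> real" and m i j
  have symc: "G y $ i $ j = G y $ j $ i" if "y \<in> U" for y i j
    using arg_cong[OF sym[OF that], of "\<lambda>M. M $ j $ i"] by (simp add: transpose_def)
  have Dsym: "D k i j = D k j i" for k i j
  proof -
    have "((\<lambda>y. G y $ j $ i) has_derivative frechet_derivative (\<lambda>y. G y $ i $ j) (at x)) (at x)"
      by (rule has_derivative_transform_within_open[OF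
            diff[unfolded frechet_derivative_works] \<open>open U\<close> \<open>x \<in> U\<close>]) (rule symc)
    then show ?thesis
      unfolding D_def partial_deriv_def by (simp add: frechet_derivative_at[symmetric])
  qed
  have GH: "(\<Sum>l\<in>UNIV. G x $ m $ l * ?H $ l $ k) = (if m = k then 1 else 0)"
    and HG: "(\<Sum>l\<in>UNIV. ?H $ m $ l * G x $ l $ k) = (if m = k then 1 else 0)" for m k
  proof -
    have "G x ** ?H = mat 1" "?H ** G x = mat 1"
      using someI_ex[OF inv[unfolded invertible_def]] unfolding matrix_inv_def by auto
    then have "(G x ** ?H) $ m $ k = mat 1 $ m $ k" "(?H ** G x) $ m $ k = mat 1 $ m $ k"
      by auto
    then show "(\<Sum>l\<in>UNIV. G x $ m $ l * ?H $ l $ k) = (if m = k then 1 else 0)"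
      "(\<Sum>l\<in>UNIV. ?H $ m $ l * G x $ l $ k) = (if m = k then 1 else 0)"
      by (auto simp: matrix_matrix_mult_def mat_def)
  qed
  have chr: "christoffel G x k i j = (\<Sum>m\<in>UNIV. ?H $ k $ m * F m i j)" for k i j
    unfolding christoffel_def F_def D_def by (simp add: sum_divide_distrib)
  have raise: "(\<Sum>m\<in>UNIV. ?H $ k $ m * L C m i j) = C k i j" for C k i j
  proof -
    have "(\<Sum>m\<in>UNIV. ?H $ k $ m * L C m i j)
        = (\<Sum>m\<in>UNIV. \<Sum>l\<in>UNIV. ?H $ k $ m * G x $ m $ l * C l i j)"
      by (simp add: L_def sum_distrib_left mult.assoc)
    also have "\<dots> = (\<Sum>l\<in>UNIV. (\<Sum>m\<in>UNIV. ?H $ k $ m * G x $ m $ l) * C l i j)"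
      by (subst sum.swap) (simp add: sum_distrib_right)
    also have "\<dots> = C k i j" 
      by (simp add: HG mult_if_delta)
    finally show ?thesis .
  qed
  have low: "L (christoffel G x) m i j = F m i j" for m i j
  proof -
    have "L (christoffel G x) m i j
        = (\<Sum>l\<in>UNIV. \<Sum>k\<in>UNIV. G x $ m $ l * ?H $ l $ k * F k i j)"
      by (simp add: L_def chr sum_distrib_left mult.assoc)
    also have "\<dots> = (\<Sum>k\<in>UNIV. (\<Sum>l\<in>UNIV. G x $ m $ l * ?H $ l $ k) * F k i j)"
      by (subst sum.swap) (simp add: sum_distrib_right)
    also have "\<dots> = F m i j" 
      by (simp add: GH mult_if_delta)
    finally show ?thesis .
  qed
  have compat: "(\<Sum>l\<in>UNIV. C l k i * G x $ l $ j + C l k j * G x $ i $ l) = L C j k i + L C i k j"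
    for C k i j
    unfolding L_def sum.distrib symc[OF \<open>x \<in> U\<close>, of j] by (simp only: mult.commute)
  show ?thesis
    unfolding compat D_def[symmetric]
  proof safe
    assume tf: "\<forall>k i j. C k i j = C k j i" and mc: "\<forall>k i j. D k i j = L C j k i + L C i k j"
    have Ls: "L C m i j = L C m j i" for m i j
      unfolding L_def by (rule sum.cong[OF refl]) (simp only: tf[rule_format, of _ i j])
    have LF: "L C m i j = F m i j" for m i j
      unfolding F_def using mc[rule_format, of i j m] mc[rule_format, of j i m]
        mc[rule_format, of m i j] Ls[of j i m] Ls[of i j m] Ls[of m i j] by simp
    then show "C = christoffel G x"
      by (intro ext) (simp only: chr LF raise[of _ C, symmetric])
  next
    fix k i j
    show "christoffel G x k i j = christoffel G x k j i"
      unfolding chr F_def by (rule sum.cong[OF refl]) (simp add: Dsym[of _ i j])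
  next
    fix k i j
    show "D k i j = L (christoffel G x) j k i + L (christoffel G x) i k j"
      unfolding low F_def using Dsym[of k i j] Dsym[of i k j] Dsym[of j k i] by (simp add: field_simps)
  qed
qed


section \<open>Curves and fields along curves\<close>

definition smooth_curve ::
    "'p topology \<Rightarrow> ('p, 'n::finite) chart set \<Rightarrow> real set \<Rightarrow> (real \<Rightarrow> 'p) \<Rightarrow> bool" where
  "smooth_curve X A I \<alpha> \<longleftrightarrow>
     continuous_map (top_of_set I) X \<alpha> \<and>
     (\<forall>c\<in>A. smooth_on {t\<in>I. \<alpha> t \<in> cdom c} (cmap c \<circ> \<alpha>))"

text \<open>A field along a curve is given by its component vectors \<open>V c t\<close> in each chart \<open>c\<close>; these
  are meaningful for those \<open>t\<close> for which \<open>\<alpha> t\<close> lies in the domain of \<open>c\<close>, and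
  \<open>in_charts\<close> imposes a condition for exactly those \<open>c\<close> and \<open>t\<close>.\<close>

type_synonym ('p, 'n) field_along = "('p, 'n) chart \<Rightarrow> real \<Rightarrow> real^'n"

definition in_charts ::
    "('p, 'n::finite) chart set \<Rightarrow> real set \<Rightarrow> (real \<Rightarrow> 'p) \<Rightarrow>
     (('p, 'n) chart \<Rightarrow> real \<Rightarrow> bool) \<Rightarrow> bool" where
  "in_charts A I \<alpha> P \<longleftrightarrow> (\<forall>c\<in>A. \<forall>t\<in>I. \<alpha> t \<in> cdom c \<longrightarrow> P c t)"

definition velocity :: "(real \<Rightarrow> 'p) \<Rightarrow> ('p, 'n::finite) field_along" where
  "velocity \<alpha> c t = vector_derivative (cmap c \<circ> \<alpha>) (at t)"

text \<open>\<open>\<nabla>\<^bsub>\<alpha>'\<^esub> V\<close> for a field \<open>V\<close> along \<open>\<alpha>\<close>\<close>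

definition cov_deriv ::
    "('p, 'n::finite) metric \<Rightarrow> (real \<Rightarrow> 'p) \<Rightarrow> ('p, 'n) field_along \<Rightarrow> ('p, 'n) field_along" where
  "cov_deriv g \<alpha> V c t = vector_derivative (V c) (at t) +
     (\<chi> k. \<Sum>i\<in>UNIV. \<Sum>j\<in>UNIV.
        christoffel (g c) (cmap c (\<alpha> t)) k i j * velocity \<alpha> c t $ i * V c t $ j)"

definition metric_form :: "real^'n^'n \<Rightarrow> real^'n::finite \<Rightarrow> real^'n \<Rightarrow> real" where
  "metric_form G u v = (\<Sum>i\<in>UNIV. \<Sum>j\<in>UNIV. G $ i $ j * u $ i * v $ j)"

text \<open>The natural volume form in a positively oriented chart in which the metric has matrix \<open>G\<close>:
  the determinant is the contraction of \<open>\<epsilon>\<^sub>i\<^sub>j\<^sub>k\<close> with the three vectors.\<close>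

definition volume_form :: "real^3^3 \<Rightarrow> real^3 \<Rightarrow> real^3 \<Rightarrow> real^3 \<Rightarrow> real" where
  "volume_form G u v w = sqrt \<bar>det G\<bar> * det (vector [u, v, w] :: real^3^3)"

definition cross_product :: "real^3^3 \<Rightarrow> real^3 \<Rightarrow> real^3 \<Rightarrow> real^3" where
  "cross_product G u v = (THE w. \<forall>z. metric_form G w z = volume_form G u v z)"

definition metric_along ::
    "('p, 'n::finite) metric \<Rightarrow> (real \<Rightarrow> 'p) \<Rightarrow> ('p, 'n) field_along \<Rightarrow> ('p, 'n) field_along \<Rightarrow>
     ('p, 'n) chart \<Rightarrow> real \<Rightarrow> real" where
  "metric_along g \<alpha> U V c t = metric_form (g c (cmap c (\<alpha> t))) (U c t) (V c t)"

definition volume_along ::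
    "('p, 3) metric \<Rightarrow> (real \<Rightarrow> 'p) \<Rightarrow>
     ('p, 3) field_along \<Rightarrow> ('p, 3) field_along \<Rightarrow> ('p, 3) field_along \<Rightarrow>
     ('p, 3) chart \<Rightarrow> real \<Rightarrow> real" where
  "volume_along g \<alpha> U V W c t = volume_form (g c (cmap c (\<alpha> t))) (U c t) (V c t) (W c t)"

definition cross_along ::
    "('p, 3) metric \<Rightarrow> (real \<Rightarrow> 'p) \<Rightarrow>
     ('p, 3) field_along \<Rightarrow> ('p, 3) field_along \<Rightarrow> ('p, 3) field_along" where
  "cross_along g \<alpha> U V c t = cross_product (g c (cmap c (\<alpha> t))) (U c t) (V c t)"


section \<open>The Frenet frame\<close>

definition arc_length_parametrized ::
    "('p, 'n::finite) chart set \<Rightarrow> ('p, 'n) metric \<Rightarrow> real set \<Rightarrow> (real \<Rightarrow> 'p) \<Rightarrow> real \<Rightarrow> bool" where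
  "arc_length_parametrized A g I \<alpha> \<epsilon>1 \<longleftrightarrow> \<epsilon>1 \<in> {1, -1} \<and>
     in_charts A I \<alpha> (\<lambda>c t. metric_along g \<alpha> (velocity \<alpha>) (velocity \<alpha>) c t = \<epsilon>1)"

abbreviation acceleration ::
    "('p, 'n::finite) metric \<Rightarrow> (real \<Rightarrow> 'p) \<Rightarrow> ('p, 'n) field_along" where
  "acceleration g \<alpha> \<equiv> cov_deriv g \<alpha> (velocity \<alpha>)"

definition nonnull_acceleration ::
    "('p, 'n::finite) chart set \<Rightarrow> ('p, 'n) metric \<Rightarrow> real set \<Rightarrow> (real \<Rightarrow> 'p) \<Rightarrow> bool" where
  "nonnull_acceleration A g I \<alpha> \<longleftrightarrow>
     in_charts A I \<alpha> (\<lambda>c t. metric_along g \<alpha> (acceleration g \<alpha>) (acceleration g \<alpha>) c t \<noteq> 0)"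

text \<open>\<open>N\<close>, \<open>B\<close>, \<open>\<kappa>\<close> and \<open>\<tau>\<close> are the normal, binormal, curvature and torsion of an arc length
  parametrized curve with non-null acceleration; the defining equations determine them on \<open>I\<close>.
  Here \<open>\<epsilon>3 = \<omega> \<epsilon>1 \<epsilon>2\<close> with \<open>\<omega> = -1\<close>, the sign of the determinant of a Lorentzian metric.\<close>

definition frenet_apparatus ::
    "('p, 3) chart set \<Rightarrow> ('p, 3) metric \<Rightarrow> real set \<Rightarrow> (real \<Rightarrow> 'p) \<Rightarrow> real \<Rightarrow> real \<Rightarrow>
     ('p, 3) field_along \<Rightarrow> ('p, 3) field_along \<Rightarrow> (real \<Rightarrow> real) \<Rightarrow> (real \<Rightarrow> real) \<Rightarrow> bool" where
  "frenet_apparatus A g I \<alpha> \<epsilon>1 \<epsilon>2 N B \<kappa> \<tau> \<longleftrightarrow>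
     (let T = velocity \<alpha>; D = cov_deriv g \<alpha>; \<epsilon>3 = - \<epsilon>1 * \<epsilon>2 in
        (\<forall>t\<in>I. \<kappa> t > 0) \<and>
        in_charts A I \<alpha> (\<lambda>c t.
          \<epsilon>2 = sgn (metric_along g \<alpha> (D T) (D T) c t) \<and>
          D T c t = (\<epsilon>2 * \<kappa> t) *\<^sub>R N c t \<and>
          metric_along g \<alpha> N N c t = \<epsilon>2 \<and>
          B c t = \<epsilon>3 *\<^sub>R cross_along g \<alpha> T N c t \<and>
          D N c t = (- \<epsilon>1 * \<kappa> t) *\<^sub>R T c t + (\<epsilon>3 * \<tau> t) *\<^sub>R B c t))"


section \<open>Equi-affine curvatures\<close>

definition affine_volume ::
    "('p, 3) metric \<Rightarrow> (real \<Rightarrow> 'p) \<Rightarrow> ('p, 3) chart \<Rightarrow> real \<Rightarrow> real" where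
  "affine_volume g \<alpha> =
     volume_along g \<alpha> (velocity \<alpha>) (acceleration g \<alpha>) (cov_deriv g \<alpha> (acceleration g \<alpha>))"

definition nondegenerate ::
    "('p, 3) chart set \<Rightarrow> ('p, 3) metric \<Rightarrow> real set \<Rightarrow> (real \<Rightarrow> 'p) \<Rightarrow> bool" where
  "nondegenerate A g I \<alpha> \<longleftrightarrow> in_charts A I \<alpha> (\<lambda>c t. affine_volume g \<alpha> c t \<noteq> 0)"

definition affine_speed ::
    "('p, 3) metric \<Rightarrow> (real \<Rightarrow> 'p) \<Rightarrow> ('p, 3) chart \<Rightarrow> real \<Rightarrow> real" where
  "affine_speed g \<alpha> c t = \<bar>affine_volume g \<alpha> c t\<bar> powr (-1/6)"

text \<open>\<open>\<nabla>\<^bsub>e1\<^esub>\<close>, where \<open>e1 = \<phi> \<alpha>'\<close> is the first vector of the Cartan frame\<close>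

definition cartan_deriv ::
    "('p, 3) metric \<Rightarrow> (real \<Rightarrow> 'p) \<Rightarrow> ('p, 3) field_along \<Rightarrow> ('p, 3) field_along" where
  "cartan_deriv g \<alpha> V c t = affine_speed g \<alpha> c t *\<^sub>R cov_deriv g \<alpha> V c t"

definition cartan_e1 :: "('p, 3) metric \<Rightarrow> (real \<Rightarrow> 'p) \<Rightarrow> ('p, 3) field_along" where
  "cartan_e1 g \<alpha> c t = affine_speed g \<alpha> c t *\<^sub>R velocity \<alpha> c t"

definition cartan_e2 :: "('p, 3) metric \<Rightarrow> (real \<Rightarrow> 'p) \<Rightarrow> ('p, 3) field_along" where
  "cartan_e2 g \<alpha> = cartan_deriv g \<alpha> (cartan_e1 g \<alpha>)"

definition cartan_e3 :: "('p, 3) metric \<Rightarrow> (real \<Rightarrow> 'p) \<Rightarrow> ('p, 3) field_along" where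
  "cartan_e3 g \<alpha> = cartan_deriv g \<alpha> (cartan_e2 g \<alpha>)"

definition equi_affine_curvatures ::
    "('p, 3) chart set \<Rightarrow> ('p, 3) metric \<Rightarrow> real set \<Rightarrow> (real \<Rightarrow> 'p) \<Rightarrow>
     (real \<Rightarrow> real) \<Rightarrow> (real \<Rightarrow> real) \<Rightarrow> bool" where
  "equi_affine_curvatures A g I \<alpha> k1 k2 \<longleftrightarrow>
     in_charts A I \<alpha> (\<lambda>c t. cartan_deriv g \<alpha> (cartan_e3 g \<alpha>) c t =
       k1 t *\<^sub>R cartan_e1 g \<alpha> c t + k2 t *\<^sub>R cartan_e2 g \<alpha> c t)"

end

(* In a parallel frame along a curve with zero equi-affine curvatures, e1 = a + b u + c u^2/2 for
   constant vectors a, b, c and du = ds/phi, exactly as in flat space. With a and c null, b orthogonal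
   to both, g(a,c) = 2 and g(b,b) = 1/4 one gets g(e1,e1) = (3u/2)^2, so phi = 3u/2, s = 3u^2/4, and
   the Frenet curvature and torsion are constant multiples of 1/s. In flat space this is a twisted
   cubic; rescaling the coordinates gives (2 s^(1/2), s, 2/3 s^(3/2)). Adding a multiple of dx1^2
   that vanishes to second order on the curve makes the metric a curved plane wave without changing
   the connection along the curve. *)

theory Submission
  imports Defs
begin

section \<open>Smooth maps\<close>

lemma frechet_derivative_eqI:
  assumes "(f has_derivative f') (at x)"
  shows "frechet_derivative f (at x) = f'"
  using frechet_derivative_at[OF assms] by simp

text \<open>On an open set, the derivative at a point depends only on nearby values inside the set.
  A formula valid on S alone can therefore replace the function at every order.\<close>

lemma Ck_on_cong:
  assumes "open S" "\<And>x. x \<in> S \<Longrightarrow> f x = g x"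
  shows "Ck_on k S f \<longleftrightarrow> Ck_on k S g"
proof -
  have "Ck_on k S f \<Longrightarrow> Ck_on k S g" if "\<And>x. x \<in> S \<Longrightarrow> f x = g x" for f g :: "'a \<Rightarrow> 'b"
    using that
  proof (induction k arbitrary: f g)
    case 0
    then show ?case using continuous_on_eq[of S f g] by auto
  next
    case (Suc k)
    have d: "f differentiable (at x)" if "x \<in> S" for x
      using Suc.prems(1) that by (simp add: differentiable_on_eq_differentiable_at[OF assms(1)])
    have D: "(g has_derivative frechet_derivative f (at x)) (at x)" if "x \<in> S" for x
      by (rule has_derivative_transform_within_open[OF d[OF that, unfolded frechet_derivative_works]
            assms(1) that]) (rule Suc.prems(2))
    have "g differentiable_on S"
      using D by (intro differentiable_at_imp_differentiable_on) (blast intro: differentiableI)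
    moreover have "Ck_on k S (\<lambda>x. frechet_derivative g (at x) b)" if "b \<in> Basis" for b
      by (rule Suc.IH[of "\<lambda>x. frechet_derivative f (at x) b"])
        (use Suc.prems(1) that frechet_derivative_eqI[OF D] in auto)
    ultimately show ?case by simp
  qed
  from this[of f g, OF assms(2)] this[of g f, OF assms(2)[symmetric]] show ?thesis by blast
qed

text \<open>Replaces the derivative chosen by \<open>frechet_derivative\<close> with an explicit
  formula; this drives the inductions below.\<close>

lemma Ck_on_SucI:
  assumes "open S" "\<And>x. x \<in> S \<Longrightarrow> (f has_derivative f' x) (at x)"
    and "\<And>b. b \<in> Basis \<Longrightarrow> Ck_on k S (\<lambda>x. f' x b)"
  shows "Ck_on (Suc k) S f"
proof -
  have "Ck_on k S (\<lambda>x. frechet_derivative f (at x) b)" if "b \<in> Basis" for b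
    using assms(3)[OF that]
    by (subst Ck_on_cong[OF assms(1), where g = "\<lambda>x. f' x b"])
      (simp_all add: frechet_derivative_eqI[OF assms(2)])
  moreover have "f differentiable_on S"
    using assms(2) by (intro differentiable_at_imp_differentiable_on) (blast intro: differentiableI)
  ultimately show ?thesis by simp
qed

lemma Ck_on_Suc_has_derivative:
  assumes "open S" "Ck_on (Suc k) S f" "x \<in> S"
  shows "(f has_derivative frechet_derivative f (at x)) (at x)"
  using assms(2,3)
  by (simp add: differentiable_on_eq_differentiable_at[OF assms(1)] flip: frechet_derivative_works)

lemma Ck_on_Suc_imp_Ck_on:
  assumes "Ck_on (Suc k) S f"
  shows "Ck_on k S f"
  using assms by (induction k arbitrary: f) (auto intro: differentiable_imp_continuous_on)

lemma Ck_on_const: "open S \<Longrightarrow> Ck_on k S (\<lambda>x. c)"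
proof (induction k arbitrary: c)
  case (Suc k)
  show ?case by (rule Ck_on_SucI[where f' = "\<lambda>x h. 0"]) (use Suc in auto)
qed simp

lemma Ck_on_bounded_linear:
  assumes "bounded_linear L" "open S"
  shows "Ck_on k S L"
proof (cases k)
  case 0
  then show ?thesis using linear_continuous_on[OF assms(1)] by simp
next
  case (Suc m)
  show ?thesis unfolding Suc
    by (rule Ck_on_SucI[where f' = "\<lambda>x. L"])
      (use assms bounded_linear_imp_has_derivative Ck_on_const in auto)
qed

lemma Ck_on_add:
  assumes "open S" "Ck_on k S f" "Ck_on k S g"
  shows "Ck_on k S (\<lambda>x. f x + g x)"
  using assms(2,3)
proof (induction k arbitrary: f g)
  case 0
  then show ?case by (simp add: continuous_on_add)
next
  case (Suc k)
  show ?case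
    by (rule Ck_on_SucI[OF assms(1) has_derivative_add[OF
            Ck_on_Suc_has_derivative[OF assms(1) Suc.prems(1)]
            Ck_on_Suc_has_derivative[OF assms(1) Suc.prems(2)]]])
      (use Suc in auto)
qed

text \<open>Product rule: each of the two terms pairs one factor with a derivative of the other. The
  induction must therefore range over all f and g, and the undifferentiated factor is used with one
  order less.\<close>

lemma (in bounded_bilinear) Ck_on:
  fixes f :: "'d::euclidean_space \<Rightarrow> 'a"
  assumes "open S" "Ck_on k S f" "Ck_on k S g"
  shows "Ck_on k S (\<lambda>x. prod (f x) (g x))"
  using assms(2,3)
proof (induction k arbitrary: f g)
  case 0
  then show ?case by (simp add: continuous_on)
next
  case (Suc k)
  show ?case
  proof (rule Ck_on_SucI[OF assms(1) FDERIV[OF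
            Ck_on_Suc_has_derivative[OF assms(1) Suc.prems(1)]
            Ck_on_Suc_has_derivative[OF assms(1) Suc.prems(2)]]])
    fix b :: 'd assume b: "b \<in> Basis"
    show "Ck_on k S (\<lambda>x. prod (f x) (frechet_derivative g (at x) b) + prod (frechet_derivative f (at x) b) (g x))"
      by (intro Ck_on_add assms(1) Suc.IH Ck_on_Suc_imp_Ck_on[OF Suc.prems(1)]
          Ck_on_Suc_imp_Ck_on[OF Suc.prems(2)]) (use Suc.prems b in simp_all)
  qed
qed

text \<open>The exponent varies in the induction because each differentiation lowers it by
  one.\<close>

lemma Ck_on_powr: "Ck_on k {0<..} (\<lambda>x::real. x powr a)"
proof (induction k arbitrary: a)
  case 0
  show ?case by (auto intro!: continuous_intros)
next
  case (Suc k)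
  show ?case
  proof (rule Ck_on_SucI[where f' = "\<lambda>x h. a * x powr (a - 1) * h"])
    fix x :: real assume "x \<in> {0<..}"
    then show "((\<lambda>x. x powr a) has_derivative (\<lambda>h. (a * x powr (a - 1)) * h)) (at x)"
      using has_real_derivative_powr[of x a] by (simp add: has_field_derivative_def)
  next
    fix b :: real
    show "Ck_on k {0<..} (\<lambda>x. a * x powr (a - 1) * b)"
      by (intro bounded_bilinear.Ck_on[OF bounded_bilinear_mult] Ck_on_const Suc.IH) auto
  qed auto
qed

lemmas Ck_on_intros = Ck_on_const Ck_on_add Ck_on_powr
  bounded_bilinear.Ck_on[OF bounded_bilinear_mult]
  bounded_bilinear.Ck_on[OF bounded_bilinear_scaleR]


section \<open>Vectors and matrices\<close>

lemma vector_3_eq_iff: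
  "(vector [a, b, c] :: 'a::zero^3) = vector [a', b', c'] \<longleftrightarrow> a = a' \<and> b = b' \<and> c = c'"
  by (auto simp: vec_eq_iff forall_3)

lemma scaleR_vector_3: "r *\<^sub>R (vector [a, b, c] :: real^3) = vector [r * a, r * b, r * c]"
  by (simp add: vec_eq_iff forall_3)

lemma add_vector_3:
  "(vector [a, b, c] :: real^3) + vector [a', b', c'] = vector [a + a', b + b', c + c']"
  by (simp add: vec_eq_iff forall_3)

lemma has_vector_derivative_vector_3:
  assumes "(f has_real_derivative f') (at t)" "(g has_real_derivative g') (at t)"
    "(h has_real_derivative h') (at t)"
  shows "((\<lambda>s. vector [f s, g s, h s] :: real^3) has_vector_derivative vector [f', g', h']) (at t)"
proof -
  have "((\<lambda>s. f s *\<^sub>R axis 1 1 + g s *\<^sub>R axis 2 1 + h s *\<^sub>R (axis 3 1 :: real^3))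
      has_vector_derivative (f' *\<^sub>R axis 1 1 + g' *\<^sub>R axis 2 1 + h' *\<^sub>R axis 3 1)) (at t)"
    using assms by (auto intro!: derivative_eq_intros)
  moreover have "a *\<^sub>R axis 1 1 + b *\<^sub>R axis 2 1 + c *\<^sub>R (axis 3 1 :: real^3) = vector [a, b, c]" for a b c
    by (simp add: vec_eq_iff forall_3 axis_def)
  ultimately show ?thesis by simp
qed

lemma matrix_inv_eqI:
  fixes A :: "'a::semiring_1^'n^'n"
  assumes "A ** B = mat 1" "B ** A = mat 1"
  shows "matrix_inv A = B"
proof -
  have "matrix_inv A = matrix_inv A ** (A ** B)" by (simp add: assms)
  also have "\<dots> = B"
    using someI[of "\<lambda>A'. A ** A' = mat 1 \<and> A' ** A = mat 1" B] assms
    unfolding matrix_inv_def matrix_mul_assoc by simp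
  finally show ?thesis .
qed

lemma partial_deriv_eqI:
  assumes "(f has_derivative f') (at x)"
  shows "partial_deriv k f x = f' (axis k 1)"
  by (simp add: partial_deriv_def frechet_derivative_eqI[OF assms])

text \<open>Invertibility of G makes the vector representing a linear form unique, so one candidate
  satisfying the defining identity settles the definite description.\<close>

lemma cross_product_eqI:
  assumes "invertible G" "\<And>z. metric_form G w z = volume_form G u v z"
  shows "cross_product G u v = w"
  unfolding cross_product_def
proof (rule the_equality)
  fix w' assume w': "\<forall>z. metric_form G w' z = volume_form G u v z"
  \<comment> \<open>Testing against the coordinate axes recovers the components of
    \<open>a v* G\<close>, where invertibility can be applied.\<close>
  have mf: "metric_form G a (axis j 1) = (a v* G) $ j" for a j
    by (simp add: metric_form_def vector_matrix_mult_def axis_def if_distrib mult.commute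
        cong: if_cong)
  have "w' v* G = w v* G"
    using w' assms(2) by (simp add: vec_eq_iff flip: mf)
  then show "w' = w"
    using assms(1) by (metis invertible_def vector_matrix_mul_assoc vector_matrix_mul_rid)
qed (use assms(2) in auto)


section \<open>A plane wave metric\<close>

text \<open>This is H dx1^2 + (8/9) dx1 dx3 + (1/9) dx2^2, which is Minkowski space in null
  coordinates when H = 0. The constants are chosen so that, where H = 0, the velocity (1/sqrt s, 1,
  sqrt s) has square 8/9 + 1/9 = 1.\<close>

definition pp_wave :: "(real^3 \<Rightarrow> real) \<Rightarrow> real^3 \<Rightarrow> real^3^3" where
  "pp_wave H x = vector [vector [H x, 0, 4/9], vector [0, 1/9, 0], vector [4/9, 0, 0]]"

lemma pp_wave_inverse:
  fixes H :: "real^3 \<Rightarrow> real"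
  defines "K \<equiv> \<lambda>x. vector [vector [0, 0, 9/4], vector [0, 9, 0], vector [9/4, 0, - (81/16) * H x]]"
  shows "pp_wave H x ** K x = mat 1" "K x ** pp_wave H x = mat 1"
  unfolding K_def pp_wave_def
  by (simp_all add: vec_eq_iff forall_3 matrix_matrix_mult_def sum_3 mat_def)

lemmas matrix_inv_pp_wave = matrix_inv_eqI[OF pp_wave_inverse]

lemma invertible_pp_wave: "invertible (pp_wave H x)"
  using pp_wave_inverse unfolding invertible_def by blast

lemma volume_form_pp_wave: "volume_form (pp_wave H x) u v w = 4/27 * det (vector [u, v, w] :: real^3^3)"
proof -
  have "det (pp_wave H x) = - (4/27)\<^sup>2"
    by (simp add: pp_wave_def det_3 power2_eq_square)
  then show ?thesis by (simp add: volume_form_def real_sqrt_mult)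
qed

lemma lorentzian_matrix_pp_wave: "lorentzian_matrix (pp_wave H x)"
proof -
  \<comment> \<open>The columns are an orthonormal frame. The third coordinate direction is null, so
    adding suitable multiples of it to the first gives orthogonal vectors of squares 1 and -1; the
    middle direction only needs the factor 3.\<close>
  define P :: "real^3^3" where "P = vector [vector [1, 0, 1], vector [0, 3, 0],
    vector [9/8 * (1 - H x), 0, 9/8 * (- 1 - H x)]]"
  have "det P \<noteq> 0" by (simp add: P_def det_3 field_simps)
  then have "invertible P" by (simp add: invertible_det_nz)
  moreover have "transpose P ** pp_wave H x ** P = (\<chi> i j. if i = j then if i = 3 then -1 else 1 else 0)"
    by (simp add: P_def pp_wave_def vec_eq_iff forall_3 matrix_matrix_mult_def sum_3 transpose_def
        field_simps)
  moreover have "transpose (pp_wave H x) = pp_wave H x"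
    by (simp add: pp_wave_def vec_eq_iff forall_3 transpose_def)
  ultimately show ?thesis unfolding lorentzian_matrix_def by blast
qed

text \<open>The hypothesis says that H has no x3-derivative at x. H itself enters the inverse only
  in the (3,3) entry, whose cofactor in the Christoffel formula then vanishes, so only the first
  derivatives p and q survive.\<close>

lemma christoffel_pp_wave:
  assumes "(H has_derivative (\<lambda>v. p * v $ 1 + q * v $ 2)) (at x)"
  shows "christoffel (pp_wave H) x k i j =
    (if k = 2 \<and> i = 1 \<and> j = 1 then - 9/2 * q
     else if k = 3 \<and> i = 1 \<and> j = 1 then 9/8 * p
     else if k = 3 \<and> (i = 1 \<and> j = 2 \<or> i = 2 \<and> j = 1) then 9/8 * q else 0)"
proof -
  have eq: "(\<lambda>y. pp_wave H y $ 1 $ 1) = H"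
    "(\<lambda>y. pp_wave H y $ 1 $ 2) = (\<lambda>y. 0)" "(\<lambda>y. pp_wave H y $ 1 $ 3) = (\<lambda>y. 4/9)"
    "(\<lambda>y. pp_wave H y $ 2 $ 1) = (\<lambda>y. 0)" "(\<lambda>y. pp_wave H y $ 2 $ 2) = (\<lambda>y. 1/9)"
    "(\<lambda>y. pp_wave H y $ 2 $ 3) = (\<lambda>y. 0)"
    "(\<lambda>y. pp_wave H y $ 3 $ 1) = (\<lambda>y. 4/9)" "(\<lambda>y. pp_wave H y $ 3 $ 2) = (\<lambda>y. 0)"
    "(\<lambda>y. pp_wave H y $ 3 $ 3) = (\<lambda>y. 0)"
    by (simp_all add: pp_wave_def fun_eq_iff)
  have c: "partial_deriv m (\<lambda>y. r) x = 0" for m :: 3 and r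
    by (simp add: partial_deriv_eqI[OF has_derivative_const])
  have h: "partial_deriv 1 H x = p" "partial_deriv 2 H x = q" "partial_deriv 3 H x = 0"
    by (simp_all add: partial_deriv_eqI[OF assms] axis_def)
  have "\<forall>k i j. christoffel (pp_wave H) x k i j =
    (if k = 2 \<and> i = 1 \<and> j = 1 then - 9/2 * q
     else if k = 3 \<and> i = 1 \<and> j = 1 then 9/8 * p
     else if k = 3 \<and> (i = 1 \<and> j = 2 \<or> i = 2 \<and> j = 1) then 9/8 * q else 0)"
    unfolding christoffel_def matrix_inv_pp_wave sum_3 forall_3 eq c h by simp
  then show ?thesis by blast
qed

text \<open>The curve lies on the parabolic cylinder x1^2 = 4 x2. Squaring its equation makes the
  value and the gradient vanish there, but not the second derivatives, which carry the
  curvature.\<close>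

definition profile :: "real^3 \<Rightarrow> real" where
  "profile x = (4 * x $ 2 - (x $ 1)\<^sup>2)\<^sup>2"

lemmas has_derivative_vec_nth = bounded_linear_imp_has_derivative[OF bounded_linear_vec_nth]

lemma has_derivative_profile:
  "(profile has_derivative (\<lambda>v. (- 4 * x $ 1 * (4 * x $ 2 - (x $ 1)\<^sup>2)) * v $ 1
     + (8 * (4 * x $ 2 - (x $ 1)\<^sup>2)) * v $ 2)) (at x)"
  unfolding profile_def by (rule derivative_eq_intros has_derivative_vec_nth refl | simp add: algebra_simps)+

lemmas christoffel_profile = christoffel_pp_wave[OF has_derivative_profile]

text \<open>The second x2-derivative of the profile is 32, and -9/2 * 32 = -144. The other
  derivative term and the quadratic terms vanish.\<close>

lemma riemann_profile: "riemann (pp_wave profile) x 2 1 2 1 = - 144"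
proof -
  have "((\<lambda>y::real^3. - 9/2 * (8 * (4 * y $ 2 - (y $ 1)\<^sup>2))) has_derivative
      (\<lambda>v. - 36 * (4 * v $ 2 - 2 * x $ 1 * v $ 1))) (at x)"
    by (rule derivative_eq_intros has_derivative_vec_nth refl | simp add: algebra_simps)+
  from partial_deriv_eqI[OF this, of 2]
  have "partial_deriv 2 (\<lambda>y. christoffel (pp_wave profile) y 2 1 1) x = - 144"
    by (simp add: christoffel_profile axis_def)
  moreover have "partial_deriv 1 (\<lambda>y. christoffel (pp_wave profile) y 2 2 1) x = 0"
    by (simp add: christoffel_profile partial_deriv_eqI[OF has_derivative_const])
  ultimately show ?thesis
    by (simp add: riemann_def sum_3 christoffel_profile)
qed

lemma smooth_pp_wave_profile: "smooth_on UNIV (pp_wave profile)"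
proof -
  \<comment> \<open>A constant matrix plus a polynomial multiple of an elementary matrix; the
    polynomial is spelled out in sums and products to fit the closure rules.\<close>
  have "pp_wave profile = (\<lambda>x. (\<chi> i j. pp_wave (\<lambda>_. 0) 0 $ i $ j)
    + ((4 * x $ 2 + (- 1) * (x $ 1 * x $ 1)) * (4 * x $ 2 + (- 1) * (x $ 1 * x $ 1)))
      *\<^sub>R axis 1 (axis 1 1))"
    by (simp add: pp_wave_def profile_def fun_eq_iff vec_eq_iff forall_3 axis_def power2_eq_square)
  moreover have "Ck_on k UNIV \<dots>" for k
    by (intro Ck_on_intros Ck_on_bounded_linear bounded_linear_vec_nth open_UNIV)
  ultimately show ?thesis unfolding smooth_on_def by simp
qed


section \<open>The curve\<close>

definition std_chart :: "(real^3, 3) chart" where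
  "std_chart = \<lparr>cdom = UNIV, cmap = id\<rparr>"

lemma std_chart_simps [simp]: "cdom std_chart = UNIV" "cmap std_chart = id"
  by (simp_all add: std_chart_def)

lemma transition_std_chart: "transition std_chart std_chart = id"
  by (simp add: transition_def inv_id)

lemma jacobian_id: "jacobian id (at (x::real^3)) = mat 1"
  unfolding jacobian_def id_def by (simp add: frechet_derivative_ident matrix_id_mat_1[unfolded id_def])

text \<open>The only transition map is the identity, so compatibility of charts, orientation and
  metric is immediate; what remains is topology.\<close>

lemma oriented_lorentzian_manifold_std_chart:
  assumes "smooth_on UNIV G" "\<And>x. lorentzian_matrix (G x)"
  shows "oriented_lorentzian_manifold euclidean {std_chart} (\<lambda>_. G)"
proof -
  have "smooth_on UNIV (id :: real^3 \<Rightarrow> real^3)"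
    unfolding smooth_on_def id_def by (simp add: Ck_on_bounded_linear bounded_linear_ident)
  moreover have "second_countable (euclidean :: (real^3) topology)"
  proof -
    obtain B :: "(real^3) set set" where B: "countable B" "topological_basis B"
      using ex_countable_basis by blast
    have ex: "\<exists>V\<in>B. x \<in> V \<and> V \<subseteq> U" if "open U" "x \<in> U" for U x
      using topological_basisE[OF B(2) that] by blast
    then show ?thesis
      unfolding second_countable_def
      by (intro exI[of _ B]) (simp add: B(1) ex topological_basis_open[OF B(2)])
  qed
  moreover have "connected_space (euclidean :: (real^3) topology)"
    by (metis connectedin_topspace connectedin_iff_connected connected_UNIV topspace_euclidean)
  moreover have "lorentzian_metric {std_chart} (\<lambda>_. G)"
    using assms unfolding lorentzian_metric_def
    by (simp add: transition_std_chart jacobian_id Let_def transpose_mat)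
  moreover have "oriented_atlas {std_chart}"
    by (simp add: oriented_atlas_def transition_std_chart jacobian_id)
  moreover have "homeomorphic_map euclidean euclidean (id :: real^3 \<Rightarrow> real^3)"
    by simp
  ultimately show ?thesis
    unfolding oriented_lorentzian_manifold_def smooth_manifold_def
    by (simp add: transition_std_chart)
qed

section \<open>The curve and covariant differentiation along it\<close>

definition curve :: "real \<Rightarrow> real^3" where
  "curve s = vector [2 * s powr (1/2), s, 2/3 * s powr (3/2)]"

text \<open>Real powers suit the smoothness proof; square roots suit the explicit
  derivatives.\<close>

lemma curve_eq: "0 < s \<Longrightarrow> curve s = vector [2 * sqrt s, s, 2/3 * s * sqrt s]"
  using powr_add[of s 1 "1/2"] by (simp add: curve_def powr_half_sqrt mult.assoc)

lemma smooth_curve_curve: "smooth_curve euclidean {std_chart} {0<..} curve"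
proof -
  have "curve = (\<lambda>s. (2 * s powr (1/2)) *\<^sub>R axis 1 1 + (s *\<^sub>R axis 2 1 + (2/3 * s powr (3/2)) *\<^sub>R axis 3 1))"
    by (simp add: curve_def fun_eq_iff vec_eq_iff forall_3 axis_def)
  moreover have "Ck_on k {0<..} \<dots>" for k
    by (intro Ck_on_intros Ck_on_bounded_linear bounded_linear_ident open_greaterThan)
  ultimately have C: "Ck_on k {0<..} curve" for k by simp
  from C[of 0] C show ?thesis
    by (simp add: smooth_curve_def smooth_on_def greaterThan_def)
qed

text \<open>Since (2 sqrt s)^2 = 4 s, the curve stays in the double zero set of the profile. Along
  it, both metric and connection coincide with the flat ones.\<close>

lemma profile_curve:
  assumes "0 < s"
  shows "profile (curve s) = 0" "christoffel (pp_wave profile) (curve s) k i j = 0"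
  using assms by (simp_all add: curve_eq profile_def christoffel_profile power_mult_distrib)

lemma metric_along_curve:
  assumes "0 < s" "U std_chart s = vector [a, b, c]" "V std_chart s = vector [a', b', c']"
  shows "metric_along (\<lambda>_. pp_wave profile) curve U V std_chart s = (4 * (a * c' + c * a') + b * b') / 9"
  using assms by (simp add: metric_along_def metric_form_def sum_3 pp_wave_def profile_curve field_simps)

text \<open>With vanishing Christoffel symbols the covariant derivative is the ordinary one. A
  closed form F valid for positive parameters suffices, because these form an open set.\<close>

lemma cov_deriv_curve:
  assumes "0 < s" "\<And>r. 0 < r \<Longrightarrow> V std_chart r = F r" "(F has_vector_derivative F') (at s)"
  shows "cov_deriv (\<lambda>_. pp_wave profile) curve V std_chart s = F'"
proof -
  have "(V std_chart has_vector_derivative F') (at s)"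
    by (rule has_vector_derivative_transform_within_open[OF assms(3), of "{0<..}"]) (use assms in auto)
  then have "vector_derivative (V std_chart) (at s) = F'"
    by (rule vector_derivative_at)
  then show ?thesis
    using assms(1) by (simp add: cov_deriv_def profile_curve zero_vec_def[symmetric])
qed

lemma cov_deriv_curve_vector_3:
  assumes "0 < s" "\<And>r. 0 < r \<Longrightarrow> V std_chart r = vector [a r, b r, c r]"
    "(a has_real_derivative a') (at s)" "(b has_real_derivative b') (at s)"
    "(c has_real_derivative c') (at s)"
  shows "cov_deriv (\<lambda>_. pp_wave profile) curve V std_chart s = vector [a', b', c']"
  by (rule cov_deriv_curve[OF assms(1) _ has_vector_derivative_vector_3[OF assms(3-5)]])
    (rule assms(2))

lemma velocity_curve:
  assumes "0 < s"
  shows "velocity curve std_chart s = vector [1 / sqrt s, 1, sqrt s]"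
proof -
  have "((\<lambda>s. vector [2 * sqrt s, s, 2/3 * s * sqrt s] :: real^3) has_vector_derivative
      vector [1 / sqrt s, 1, sqrt s]) (at s)"
    using assms
    by (intro has_vector_derivative_vector_3)
      (auto intro!: derivative_eq_intros simp: field_simps)
  then have "(curve has_vector_derivative vector [1 / sqrt s, 1, sqrt s]) (at s)"
    by (rule has_vector_derivative_transform_within_open[of _ _ _ "{0<..}"])
      (use assms curve_eq in auto)
  then show ?thesis by (simp add: velocity_def vector_derivative_at)
qed

lemma acceleration_curve:
  assumes "0 < s"
  shows "acceleration (\<lambda>_. pp_wave profile) curve std_chart s
    = vector [- 1 / (2 * s * sqrt s), 0, 1 / (2 * sqrt s)]"
  by (rule cov_deriv_curve_vector_3[OF assms], rule velocity_curve, assumption)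
    (use assms in \<open>auto intro!: derivative_eq_intros simp: field_simps\<close>)

text \<open>The negative sign gives \<open>\<epsilon>2 = -1\<close>, and the square root of the
  absolute value is the Frenet curvature sqrt 2 / (3 s).\<close>

lemma metric_acceleration_curve:
  assumes "0 < s"
  shows "metric_along (\<lambda>_. pp_wave profile) curve (acceleration (\<lambda>_. pp_wave profile) curve)
    (acceleration (\<lambda>_. pp_wave profile) curve) std_chart s = - 2 / (9 * s\<^sup>2)"
proof -
  have "sqrt s * (s * sqrt s) = s\<^sup>2"
    using assms by (simp add: power2_eq_square flip: mult.assoc mult.commute[of "sqrt s" s])
  then show ?thesis
    by (simp add: assms metric_along_curve acceleration_curve mult_ac)
qed

section \<open>Affine volume and Cartan frame\<close>

lemma jerk_curve:
  assumes "0 < s"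
  shows "cov_deriv (\<lambda>_. pp_wave profile) curve (acceleration (\<lambda>_. pp_wave profile) curve) std_chart s
    = vector [3 / (4 * s\<^sup>2 * sqrt s), 0, - 1 / (4 * s * sqrt s)]"
  by (rule cov_deriv_curve_vector_3[OF assms], rule acceleration_curve, assumption)
    (use assms in \<open>auto intro!: derivative_eq_intros simp: field_simps power2_eq_square\<close>)

lemma affine_volume_curve:
  assumes "0 < s"
  shows "affine_volume (\<lambda>_. pp_wave profile) curve std_chart s = 1 / (27 * s ^ 3)"
  using assms
  by (simp add: affine_volume_def volume_along_def volume_form_pp_wave det_3
      velocity_curve acceleration_curve jerk_curve field_simps power2_eq_square power3_eq_cube)

lemma affine_speed_curve:
  assumes "0 < s"
  shows "affine_speed (\<lambda>_. pp_wave profile) curve std_chart s = sqrt 3 * sqrt s"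
proof -
  \<comment> \<open>Written as a real power so that the exponents multiply: (-3) * (-1/6) =
    1/2.\<close>
  have "1 / (27 * s ^ 3) = (3 * s) powr (- 3)"
    using assms by (simp add: powr_minus powr_realpow powr_numeral field_simps)
  then have "(1 / (27 * s ^ 3)) powr (- 1/6) = (3 * s) powr (1/2)"
    by (simp add: powr_powr)
  then show ?thesis
    using assms by (simp add: affine_speed_def affine_volume_curve powr_half_sqrt real_sqrt_mult)
qed

text \<open>The components are polynomials of degree at most two in sqrt s, which is proportional to
  the affine parameter. Each Cartan derivative lowers the degree, so \<open>cartan_e3\<close> is
  constant and both equi-affine curvatures vanish.\<close>

lemma cartan_e1_curve:
  assumes "0 < s"
  shows "cartan_e1 (\<lambda>_. pp_wave profile) curve std_chart s
    = vector [sqrt 3, sqrt 3 * sqrt s, sqrt 3 * s]"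
  using assms by (simp add: cartan_e1_def affine_speed_curve velocity_curve scaleR_vector_3 mult.assoc)

lemma cartan_e2_curve:
  assumes "0 < s"
  shows "cartan_e2 (\<lambda>_. pp_wave profile) curve std_chart s = vector [0, 3/2, 3 * sqrt s]"
proof -
  have "cov_deriv (\<lambda>_. pp_wave profile) curve (cartan_e1 (\<lambda>_. pp_wave profile) curve) std_chart s
      = vector [0, sqrt 3 / (2 * sqrt s), sqrt 3]"
    by (rule cov_deriv_curve_vector_3[OF assms], rule cartan_e1_curve, assumption)
      (use assms in \<open>auto intro!: derivative_eq_intros simp: field_simps\<close>)
  then show ?thesis
    using assms
    by (simp add: cartan_e2_def cartan_deriv_def affine_speed_curve scaleR_vector_3
        vector_3_eq_iff field_simps)
qed

lemma cartan_e3_curve: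
  assumes "0 < s"
  shows "cartan_e3 (\<lambda>_. pp_wave profile) curve std_chart s = vector [0, 0, 3/2 * sqrt 3]"
proof -
  have "cov_deriv (\<lambda>_. pp_wave profile) curve (cartan_e2 (\<lambda>_. pp_wave profile) curve) std_chart s
      = vector [0, 0, 3 / (2 * sqrt s)]"
    by (rule cov_deriv_curve_vector_3[OF assms], rule cartan_e2_curve, assumption)
      (use assms in \<open>auto intro!: derivative_eq_intros simp: field_simps\<close>)
  then show ?thesis
    using assms
    by (simp add: cartan_e3_def cartan_deriv_def affine_speed_curve scaleR_vector_3
        vector_3_eq_iff)
qed

lemma equi_affine_curvatures_curve:
  "equi_affine_curvatures {std_chart} (\<lambda>_. pp_wave profile) {0<..} curve (\<lambda>_. 0) (\<lambda>_. 0)"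
proof -
  have "cov_deriv (\<lambda>_. pp_wave profile) curve (cartan_e3 (\<lambda>_. pp_wave profile) curve) std_chart s = 0"
    if "0 < s" for s
    by (rule cov_deriv_curve[OF that _ has_vector_derivative_const]) (rule cartan_e3_curve)
  then show ?thesis
    by (simp add: equi_affine_curvatures_def in_charts_def cartan_deriv_def)
qed

section \<open>Frenet frame, curvature and torsion\<close>

lemma frenet_apparatus_curve:
  "frenet_apparatus {std_chart} (\<lambda>_. pp_wave profile) {0<..} curve 1 (- 1)
     (\<lambda>_ s. vector [3 / (2 * sqrt 2 * sqrt s), 0, - 3 / (2 * sqrt 2) * sqrt s])
     (\<lambda>_ s. vector [- 1 / (2 * sqrt 2 * sqrt s), 2 * sqrt 2, - 1 / (2 * sqrt 2) * sqrt s])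
     (\<lambda>s. sqrt 2 / (3 * s)) (\<lambda>s. 1 / (6 * s))"
proof -
  let ?g = "\<lambda>_. pp_wave profile"
  \<comment> \<open>Since \<open>\<epsilon>2 = -1\<close>, the normal is minus the acceleration
    divided by the curvature.\<close>
  let ?N = "\<lambda>_ s. vector [3 / (2 * sqrt 2 * sqrt s), 0, - 3 / (2 * sqrt 2) * sqrt s] :: real^3"
  let ?B = "\<lambda>_ s. vector [- 1 / (2 * sqrt 2 * sqrt s), 2 * sqrt 2, - 1 / (2 * sqrt 2) * sqrt s] :: real^3"
  have DN: "cov_deriv ?g curve ?N std_chart s
      = vector [- 3 / (4 * sqrt 2 * s * sqrt s), 0, - 3 / (4 * sqrt 2 * sqrt s)]" if "0 < s" for s
    by (rule cov_deriv_curve_vector_3[OF that], rule refl)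
      (use that in \<open>auto intro!: derivative_eq_intros simp: field_simps\<close>)
  \<comment> \<open>Here \<open>\<epsilon>3 = - 1 * (- 1) = 1\<close>, so the binormal is T x N
    without a sign change.\<close>
  have B: "cross_along ?g curve (velocity curve) ?N std_chart s = ?B std_chart s" if "0 < s" for s
    unfolding cross_along_def
  proof (rule cross_product_eqI[OF invertible_pp_wave])
    fix z :: "real^3"
    have sqrt2: "sqrt 2 * (sqrt 2 * x) = 2 * x" for x :: real
      by (simp flip: mult.assoc)
    show "metric_form (pp_wave profile (cmap std_chart (curve s))) (?B std_chart s) z =
      volume_form (pp_wave profile (cmap std_chart (curve s))) (velocity curve std_chart s) (?N std_chart s) z"
      using that unfolding volume_form_pp_wave
      by (simp add: metric_form_def sum_3 det_3 velocity_curve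
          pp_wave_def profile_curve field_simps sqrt2)
  qed
  have N: "metric_along ?g curve ?N ?N std_chart s = - 1" if "0 < s" for s
    using that by (simp add: metric_along_curve[OF that refl refl] field_simps)
  have T: "acceleration ?g curve std_chart s = ((- 1) * (sqrt 2 / (3 * s))) *\<^sub>R ?N std_chart s"
    if "0 < s" for s
    using that by (simp add: acceleration_curve scaleR_vector_3 vector_3_eq_iff field_simps)
  \<comment> \<open>The middle component of the derivative of N is 0, which forces the curvature to
    be 2 sqrt 2 times the torsion; hence the torsion 1 / (6 s).\<close>
  have DN': "cov_deriv ?g curve ?N std_chart s = (- 1 * (sqrt 2 / (3 * s))) *\<^sub>R velocity curve std_chart s
      + (1 / (6 * s)) *\<^sub>R ?B std_chart s" if "0 < s" for s
    unfolding DN[OF that] velocity_curve[OF that] scaleR_vector_3 add_vector_3 vector_3_eq_iff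
    using that by (simp add: field_simps)
  show ?thesis
    unfolding frenet_apparatus_def Let_def in_charts_def
    by (use T N B DN' metric_acceleration_curve in \<open>auto simp: sgn_if\<close>)
qed

theorem mainTheorem4:
  shows "\<exists>(X :: (real^3) topology) A g I \<alpha> \<epsilon>1 \<epsilon>2 N B \<kappa> \<tau> k1 k2.
           oriented_lorentzian_manifold X A g \<and> \<not> flat A g \<and>
           open I \<and> is_interval I \<and> I \<noteq> {} \<and>
           smooth_curve X A I \<alpha> \<and>
           arc_length_parametrized A g I \<alpha> \<epsilon>1 \<and>
           nonnull_acceleration A g I \<alpha> \<and>
           nondegenerate A g I \<alpha> \<and>
           equi_affine_curvatures A g I \<alpha> k1 k2 \<and>
           (\<forall>t\<in>I. k1 t = 0 \<and> k2 t = 0) \<and>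
           frenet_apparatus A g I \<alpha> \<epsilon>1 \<epsilon>2 N B \<kappa> \<tau> \<and>
           \<not> \<kappa> constant_on I \<and> \<not> \<tau> constant_on I"
proof -
  let ?g = "\<lambda>_. pp_wave profile"
  let ?I = "{0<..} :: real set"
  have "oriented_lorentzian_manifold euclidean {std_chart} ?g"
    by (intro oriented_lorentzian_manifold_std_chart smooth_pp_wave_profile lorentzian_matrix_pp_wave)
  moreover have "\<not> flat {std_chart} ?g"
  proof
    assume "flat {std_chart} ?g"
    then have "\<forall>l k i j. riemann (pp_wave profile) 0 l k i j = 0"
      by (simp add: flat_def)
    with riemann_profile[of 0] show False by simp
  qed
  moreover have "open ?I" "is_interval ?I" "?I \<noteq> {}"
    by (auto simp: is_interval_1 intro: gt_ex)
  moreover have "arc_length_parametrized {std_chart} ?g ?I curve 1"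
    by (auto simp: arc_length_parametrized_def in_charts_def metric_along_curve velocity_curve)
  moreover have "nonnull_acceleration {std_chart} ?g ?I curve"
    by (auto simp: nonnull_acceleration_def in_charts_def metric_acceleration_curve)
  moreover have "nondegenerate {std_chart} ?g ?I curve"
    by (auto simp: nondegenerate_def in_charts_def affine_volume_curve)
  \<comment> \<open>Curvature and torsion are both nonzero multiples of 1/s, so one comparison of
    the values at 1 and 2 covers them.\<close>
  moreover have "\<not> (\<lambda>s. c / (d * s)) constant_on ?I" if "c \<noteq> 0" "d \<noteq> 0" for c d :: real
  proof
    assume "(\<lambda>s. c / (d * s)) constant_on ?I"
    then obtain e where e: "\<And>s. 0 < s \<Longrightarrow> c / (d * s) = e"
      unfolding constant_on_def by auto
    show False using e[of 1] e[of 2] that by (simp add: field_simps)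
  qed
  then have "\<not> (\<lambda>s. sqrt 2 / (3 * s)) constant_on ?I" "\<not> (\<lambda>s. 1 / (6 * s)) constant_on ?I"
    by auto
  moreover note smooth_curve_curve equi_affine_curvatures_curve frenet_apparatus_curve
  ultimately show ?thesis by blast
qed

end
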